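(* Let $\mathcal{X}$ be a smooth, strictly convex Banach space, and suppose that $\mu$ is a nonatomic probability measure in $\mathcal{X}$. If $\mu$ is not entirely supported on a line in $\mathcal{X}$, the spatial distribution map $\mathbf{x}\mapsto S_{\mathbf{x}}$ is strictly monotone, that is, $(S_{\mathbf{x}}-S_{\mathbf{y}})(\mathbf{x}-\mathbf{y})>0$ for all $\mathbf{x},\mathbf{y}\in\mathcal{X}$ with $\mathbf{x}\ne\mathbf{y}$. The range of the spatial distribution map is the entire open unit ball in $\mathcal{X}^*$ if $\mathcal{X}$ is reflexive (i.e., $\mathcal{X}=\mathcal{X}^{**}$). If the norm in $\mathcal{X}$ is Fréchet differentiable, the spatial distribution map is continuous.
   Context: $\mathcal{X}^*$ denotes the dual of the (real) Banach space $\mathcal{X}$, i.e. the Banach space of all continuous real-valued linear functions on $\mathcal{X}$. $\mathcal{X}$ is smooth if its norm is Gâteaux differentiable at each nonzero $\mathbf{x}\in\mathcal{X}$; the derivative is $\mathrm{SGN}_{\mathbf{x}}\in\mathcal{X}^*$, $\mathrm{SGN}_{\mathbf{x}}(\mathbf{h})=\lim_{t\to0}t^{-1}(\|\mathbf{x}+t\mathbf{h}\|-\|\mathbf{x}\|)$ for $\mathbf{h}\in\mathcal{X}$, with the convention $\mathrm{SGN}_{\mathbf{0}}=\mathbf{0}$. The norm is Fréchet differentiable if, at each nonzero $\mathbf{x}$, this limit is uniform over $\{\mathbf{h}\in\mathcal{X}:\|\mathbf{h}\|=1\}$. $\mathcal{X}$ is strictly convex if $\|(\mathbf{x}+\mathbf{y})/2\|<1$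 for any $\mathbf{x}\neq\mathbf{y}$ in $\mathcal{X}$ with $\|\mathbf{x}\|=\|\mathbf{y}\|=1$. A line in $\mathcal{X}$ through $\mathbf{x}_1$ and $\mathbf{x}_2$ is the set $\{a\mathbf{x}_1+(1-a)\mathbf{x}_2:a\in\mathbb{R}\}$. The spatial distribution at $\mathbf{x}\in\mathcal{X}$ with respect to $\mu$ is $S_{\mathbf{x}}=E\{\mathrm{SGN}_{\mathbf{x}-\mathbf{X}}\}\in\mathcal{X}^*$, where $\mathbf{X}$ is a random element of $\mathcal{X}$ with distribution $\mu$ and the expectation is in the Bochner sense; the spatial distribution map is $\mathbf{x}\mapsto S_{\mathbf{x}}$ from $\mathcal{X}$ to $\mathcal{X}^*$. Nonatomic means every singleton has measure zero.
   Formalization: The claim that the range is the entire open unit ball is stated under the preceding sentence's condition that the measure is not entirely supported on a line (it fails for the uniform law on [0,1] in the real line); the Bochner expectations defining the map are assumed to exist. *)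

theory Defs
  imports "HOL-Probability.Probability"
begin

text \<open>The dual of \<open>'a\<close> is the Banach space \<open>'a \<Rightarrow>\<^sub>L real\<close> with the operator norm.
  Properties of the space itself are predicates on its type.\<close>

definition gateaux_norm_derivative :: "'a::real_normed_vector \<Rightarrow> ('a \<Rightarrow>\<^sub>L real) \<Rightarrow> bool" where
  "gateaux_norm_derivative x f \<longleftrightarrow>
     (\<forall>h. ((\<lambda>t::real. (norm (x + t *\<^sub>R h) - norm x) / t) \<longlongrightarrow> blinfun_apply f h) (at 0))"

definition smooth_space :: "'a::real_normed_vector itself \<Rightarrow> bool" where
  "smooth_space _ \<longleftrightarrow> (\<forall>x::'a. x \<noteq> 0 \<longrightarrow> (\<exists>f. gateaux_norm_derivative x f))"

definition SGN :: "'a::real_normed_vector \<Rightarrow> 'a \<Rightarrow>\<^sub>L real" where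
  "SGN x = (if x = 0 then 0 else (THE f. gateaux_norm_derivative x f))"

definition frechet_differentiable_norm :: "'a::real_normed_vector itself \<Rightarrow> bool" where
  "frechet_differentiable_norm _ \<longleftrightarrow>
     (\<forall>x::'a. x \<noteq> 0 \<longrightarrow>
        (\<exists>f. gateaux_norm_derivative x f \<and>
             uniform_limit {h. norm h = 1}
               (\<lambda>t::real. \<lambda>h. (norm (x + t *\<^sub>R h) - norm x) / t) (blinfun_apply f) (at 0)))"

definition strictly_convex_space :: "'a::real_normed_vector itself \<Rightarrow> bool" where
  "strictly_convex_space _ \<longleftrightarrow>
     (\<forall>x y::'a. norm x = 1 \<longrightarrow> norm y = 1 \<longrightarrow> x \<noteq> y \<longrightarrow> norm ((x + y) /\<^sub>R 2) < 1)"

text \<open>Surjectivity of the canonical embedding into the bidual.\<close>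

definition reflexive_space :: "'a::real_normed_vector itself \<Rightarrow> bool" where
  "reflexive_space _ \<longleftrightarrow>
     (\<forall>\<phi>::('a \<Rightarrow>\<^sub>L real) \<Rightarrow>\<^sub>L real. \<exists>x::'a. \<forall>f. blinfun_apply \<phi> f = blinfun_apply f x)"

definition line_through :: "'a::real_vector \<Rightarrow> 'a \<Rightarrow> 'a set" where
  "line_through x1 x2 = {a *\<^sub>R x1 + (1 - a) *\<^sub>R x2 | a::real. True}"

definition supported_on_line :: "'a::real_normed_vector measure \<Rightarrow> bool" where
  "supported_on_line M \<longleftrightarrow> (\<exists>x1 x2. AE w in M. w \<in> line_through x1 x2)"

definition nonatomic :: "'a measure \<Rightarrow> bool" where
  "nonatomic M \<longleftrightarrow> (\<forall>x. emeasure M {x} = 0)"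

text \<open>The library's \<^const>\<open>has_bochner_integral\<close> needs a second countable codomain, which a dual
  space need not be. This is the Bochner integral with values in an arbitrary normed space: its
  simple functions and their integrals are those of the library, and the pointwise limit is
  strong measurability, which replaces Borel measurability of \<open>f\<close>. In particular
  \<open>norm (f w - s i w)\<close> is almost everywhere equal to a measurable function, so that the
  nonnegative integral below is not merely a lower integral.\<close>

definition has_strong_bochner_integral ::
    "'a measure \<Rightarrow> ('a \<Rightarrow> 'b::real_normed_vector) \<Rightarrow> 'b \<Rightarrow> bool" where
  "has_strong_bochner_integral M f I \<longleftrightarrow>
     (\<exists>s. (\<forall>i::nat. Bochner_Integration.simple_bochner_integrable M (s i)) \<and>
          (AE w in M. (\<lambda>i. s i w) \<longlonglongrightarrow> f w) \<and>
          (\<lambda>i. \<integral>\<^sup>+w. ennreal (norm (f w - s i w)) \<partial>M) \<longlonglongrightarrow> 0 \<and>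
          (\<lambda>i. Bochner_Integration.simple_bochner_integral M (s i)) \<longlonglongrightarrow> I)"

definition strong_bochner_integrable ::
    "'a measure \<Rightarrow> ('a \<Rightarrow> 'b::real_normed_vector) \<Rightarrow> bool" where
  "strong_bochner_integrable M f \<longleftrightarrow> (\<exists>I. has_strong_bochner_integral M f I)"

definition strong_bochner_integral ::
    "'a measure \<Rightarrow> ('a \<Rightarrow> 'b::real_normed_vector) \<Rightarrow> 'b" where
  "strong_bochner_integral M f = (THE I. has_strong_bochner_integral M f I)"

definition spatial_distribution :: "'a::real_normed_vector measure \<Rightarrow> 'a \<Rightarrow> ('a \<Rightarrow>\<^sub>L real)" where
  "spatial_distribution M x = strong_bochner_integral M (\<lambda>w. SGN (x - w))"

text \<open>On a nonseparable dual the map \<open>w \<mapsto> SGN (x - w)\<close> may fail to be strongly measurable; the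
  spatial distribution at \<open>x\<close> then does not exist. It is bounded by 1, so for a probability
  measure this is the only obstruction.\<close>

definition spatial_distribution_exists :: "'a::real_normed_vector measure \<Rightarrow> bool" where
  "spatial_distribution_exists M \<longleftrightarrow>
     (\<forall>x. strong_bochner_integrable M (\<lambda>w. SGN (x - w)))"

end

theory Submission
  imports Defs
begin

text \<open>\<open>SGN x\<close> is a subgradient of the norm at \<open>x\<close>, so the integrand of
  \<open>(S\<^sub>x - S\<^sub>y) (x - y)\<close> is nonnegative, and by strict convexity it vanishes only on the line through
  \<open>x\<close> and \<open>y\<close>. Similarly, in a reflexive space \<open>S\<^sub>x\<close> attains its norm at some \<open>h\<close>, and if that norm
  were 1 then \<open>x - w\<close> would be a multiple of \<open>h\<close> for almost every \<open>w\<close>. Conversely, for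
  \<open>\<parallel>f\<parallel> < 1\<close> the convex function \<open>x \<mapsto> E (\<parallel>x - w\<parallel> - \<parallel>w\<parallel>) - f x\<close> is coercive, hence has a
  minimizer, at which its derivative \<open>S\<^sub>x - f\<close> vanishes. Frechet differentiability makes \<open>SGN\<close>
  norm continuous off 0, and continuity of \<open>S\<close> follows by dominated convergence.\<close>

section \<open>The derivative of the norm\<close>

lemma filterlim_inverse_Suc_at_0: "filterlim (\<lambda>n. inverse (real (Suc n))) (at 0) sequentially"
  using LIMSEQ_inverse_real_of_nat by (simp add: filterlim_at del: of_nat_Suc)

lemma gateaux_norm_derivative_unique:
  assumes "gateaux_norm_derivative x f" "gateaux_norm_derivative x g"
  shows "f = g"
proof (rule blinfun_eqI)
  fix h
  show "blinfun_apply f h = blinfun_apply g h"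
    using assms unfolding gateaux_norm_derivative_def by (blast intro: LIM_unique)
qed

lemma SGN_eqI:
  assumes "x \<noteq> 0" "gateaux_norm_derivative x f"
  shows "SGN x = f"
  using assms gateaux_norm_derivative_unique by (auto simp: SGN_def)

lemma gateaux_norm_derivative_SGN:
  fixes x :: "'a::real_normed_vector"
  assumes "smooth_space TYPE('a)" "x \<noteq> 0"
  shows "gateaux_norm_derivative x (SGN x)"
  using assms SGN_eqI by (metis smooth_space_def)

text \<open>Taking \<open>t = 1 / (n + 1)\<close> gives a sequential limit, the form used for
  measurability and dominated convergence.\<close>

lemma SGN_LIMSEQ:
  fixes x h :: "'a::real_normed_vector"
  assumes "smooth_space TYPE('a)" "x \<noteq> 0"
  shows "(\<lambda>n. real (Suc n) * (norm (x + h /\<^sub>R real (Suc n)) - norm x)) \<longlonglongrightarrow> blinfun_apply (SGN x) h"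
proof -
  have "((\<lambda>t::real. (norm (x + t *\<^sub>R h) - norm x) / t) \<longlongrightarrow> blinfun_apply (SGN x) h) (at 0)"
    using gateaux_norm_derivative_SGN[OF assms] by (auto simp: gateaux_norm_derivative_def)
  from filterlim_compose[OF this filterlim_inverse_Suc_at_0]
  show ?thesis
    by (simp add: divide_inverse mult.commute)
qed

text \<open>The norm is 1-Lipschitz; the bound is uniform in \<open>c\<close> and \<open>x\<close>,
  so it can dominate the difference quotients under the integral.\<close>

lemma abs_norm_quotient_le:
  fixes x h :: "'a::real_normed_vector"
  assumes "c > 0"
  shows "\<bar>c * (norm (x + h /\<^sub>R c) - norm x)\<bar> \<le> norm h"
proof -
  have "\<bar>norm (x + h /\<^sub>R c) - norm x\<bar> \<le> norm (h /\<^sub>R c)"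
    using norm_triangle_ineq3[of "x + h /\<^sub>R c" x] by simp
  then have "c * \<bar>norm (x + h /\<^sub>R c) - norm x\<bar> \<le> c * norm (h /\<^sub>R c)"
    using assms by (intro mult_left_mono) auto
  also have "\<dots> = norm h"
    using assms by simp
  finally show ?thesis
    using assms by (simp add: abs_mult)
qed

text \<open>Convexity: \<open>x + h /\<^sub>R c\<close> is the combination of \<open>x\<close> and
  \<open>x + h\<close> with weights \<open>1 - 1 / c\<close> and \<open>1 / c\<close>.\<close>

lemma norm_quotient_le:
  fixes x h :: "'a::real_normed_vector"
  assumes "c \<ge> 1"
  shows "c * (norm (x + h /\<^sub>R c) - norm x) \<le> norm (x + h) - norm x"
proof -
  have "c *\<^sub>R (x + h /\<^sub>R c) = (c - 1) *\<^sub>R x + (x + h)"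
    using assms by (simp add: algebra_simps)
  then have "norm (c *\<^sub>R (x + h /\<^sub>R c)) \<le> norm ((c - 1) *\<^sub>R x) + norm (x + h)"
    by (metis norm_triangle_ineq)
  moreover have "norm (c *\<^sub>R (x + h /\<^sub>R c)) = c * norm (x + h /\<^sub>R c)"
    using assms by simp
  moreover have "norm ((c - 1) *\<^sub>R x) = (c - 1) * norm x"
    using assms by simp
  ultimately show ?thesis
    unfolding right_diff_distrib left_diff_distrib by linarith
qed

text \<open>By convexity every quotient with step at most 1 is bounded by the one with step 1, and
  the bound passes to the limit. At 0 the convention \<open>SGN 0 = 0\<close> suffices.\<close>

lemma SGN_subgradient:
  fixes x h :: "'a::real_normed_vector"
  assumes "smooth_space TYPE('a)"
  shows "blinfun_apply (SGN x) h \<le> norm (x + h) - norm x"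
proof (cases "x = 0")
  case True
  then show ?thesis by (simp add: SGN_def)
next
  case False
  show ?thesis
    by (rule LIMSEQ_le_const2[OF SGN_LIMSEQ[OF assms False]])
       (auto intro!: exI[of _ 0] norm_quotient_le)
qed

lemma SGN_subgradient_diff:
  fixes x y :: "'a::real_normed_vector"
  assumes "smooth_space TYPE('a)"
  shows "blinfun_apply (SGN x) (y - x) \<le> norm y - norm x"
  using SGN_subgradient[OF assms, of x "y - x"] by simp

lemma SGN_le:
  fixes x h :: "'a::real_normed_vector"
  assumes "smooth_space TYPE('a)"
  shows "blinfun_apply (SGN x) h \<le> norm h"
  using SGN_subgradient[OF assms, of x h] norm_triangle_ineq[of x h] by simp

lemma abs_SGN_le:
  fixes x h :: "'a::real_normed_vector"
  assumes "smooth_space TYPE('a)"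
  shows "\<bar>blinfun_apply (SGN x) h\<bar> \<le> norm h"
  using SGN_le[OF assms, of x h] SGN_le[OF assms, of x "-h"] by (simp add: blinfun.minus_right)

lemma SGN_self:
  fixes x :: "'a::real_normed_vector"
  assumes "smooth_space TYPE('a)"
  shows "blinfun_apply (SGN x) x = norm x"
  using SGN_subgradient[OF assms, of x "-x"] SGN_le[OF assms, of x x]
  by (simp add: blinfun.minus_right)

lemma norm_SGN_le:
  fixes x :: "'a::real_normed_vector"
  assumes "smooth_space TYPE('a)"
  shows "norm (SGN x) \<le> 1"
  using abs_SGN_le[OF assms] by (intro norm_blinfun_bound) auto

text \<open>If \<open>u\<close> and \<open>v\<close> are nonzero, \<open>SGN u\<close> takes the
  value 1 at \<open>sgn u\<close> and \<open>sgn v\<close>, hence at their midpoint, whose norm is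
  then at least 1. Strict convexity forces \<open>sgn u = sgn v\<close>.\<close>

lemma strictly_convex_SGN_eq_norm:
  fixes u v :: "'a::real_normed_vector"
  assumes smooth: "smooth_space TYPE('a)" and convex: "strictly_convex_space TYPE('a)"
    and eq: "blinfun_apply (SGN u) v = norm v"
  shows "norm u *\<^sub>R v = norm v *\<^sub>R u"
proof (cases "u = 0 \<or> v = 0")
  case True
  then show ?thesis by auto
next
  case False
  let ?m = "(sgn u + sgn v) /\<^sub>R 2"
  have "blinfun_apply (SGN u) ?m = 1"
    using False by (simp add: sgn_div_norm blinfun.add_right blinfun.scaleR_right eq SGN_self[OF smooth])
  then have "norm ?m \<ge> 1"
    using SGN_le[OF smooth, of u ?m] by simp
  then have "sgn u = sgn v"
    using convex False unfolding strictly_convex_space_def by (metis norm_sgn not_le)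
  moreover have "norm u *\<^sub>R sgn u = u" "norm v *\<^sub>R sgn v = v"
    using False by (simp_all add: sgn_div_norm)
  ultimately show ?thesis
    by (metis mult.commute scaleR_scaleR)
qed

lemma norm_blinfun_le_unit:
  fixes f :: "'a::real_normed_vector \<Rightarrow>\<^sub>L real"
  assumes "0 \<le> b" "\<And>h. norm h = 1 \<Longrightarrow> blinfun_apply f h \<le> b"
  shows "norm f \<le> b"
proof (rule norm_blinfun_bound[OF \<open>0 \<le> b\<close>])
  have *: "blinfun_apply f h \<le> b * norm h" for h
  proof (cases "h = 0")
    case False
    then have "blinfun_apply f (sgn h) \<le> b"
      by (intro assms) (simp add: norm_sgn)
    then show ?thesis
      using False by (simp add: sgn_div_norm blinfun.scaleR_right field_simps)
  qed simp
  show "norm (blinfun_apply f h) \<le> b * norm h" for h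
    using *[of h] *[of "-h"] by (simp add: blinfun.minus_right)
qed

section \<open>Norm continuity of \<open>SGN\<close> under Frechet differentiability\<close>

lemma frechet_imp_smooth:
  "frechet_differentiable_norm TYPE('a::real_normed_vector) \<Longrightarrow> smooth_space TYPE('a)"
  unfolding frechet_differentiable_norm_def smooth_space_def by blast

text \<open>At one fixed step \<open>t\<close> the quotient at \<open>x\<close> is within
  \<open>e / 2\<close> of \<open>SGN x\<close> for all unit \<open>h\<close>; the subgradient
  inequality at \<open>y\<close> compares \<open>SGN y\<close> with the same quotient.\<close>

lemma isCont_SGN:
  fixes x :: "'a::real_normed_vector"
  assumes frechet: "frechet_differentiable_norm TYPE('a)" and "x \<noteq> 0"
  shows "isCont SGN x"
proof -
  note smooth = frechet_imp_smooth[OF frechet]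
  obtain f where f: "gateaux_norm_derivative x f"
    and "uniform_limit {h. norm h = 1} (\<lambda>t h. (norm (x + t *\<^sub>R h) - norm x) / t)
      (blinfun_apply f) (at 0)"
    using assms unfolding frechet_differentiable_norm_def by blast
  then have unif: "uniform_limit {h. norm h = 1} (\<lambda>t h. (norm (x + t *\<^sub>R h) - norm x) / t)
      (blinfun_apply (SGN x)) (at 0)"
    using SGN_eqI[OF \<open>x \<noteq> 0\<close> f] by simp
  show ?thesis
    unfolding continuous_at_eps_delta
  proof (intro allI impI)
    fix e :: real assume "e > 0"
    then have "\<forall>\<^sub>F t in at 0. \<forall>h\<in>{h. norm h = 1}.
        dist ((norm (x + t *\<^sub>R h) - norm x) / t) (blinfun_apply (SGN x) h) < e / 2"
      using unif unfolding uniform_limit_iff by (meson half_gt_zero)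
    then obtain d where "d > 0" and d: "\<And>t h. t \<noteq> 0 \<Longrightarrow> \<bar>t\<bar> < d \<Longrightarrow> norm h = 1 \<Longrightarrow>
        \<bar>(norm (x + t *\<^sub>R h) - norm x) / t - blinfun_apply (SGN x) h\<bar> < e / 2"
      unfolding eventually_at by (auto simp: dist_real_def)
    define t where "t = d / 2"
    have t: "t > 0" "t < d" using \<open>d > 0\<close> by (auto simp: t_def)
    \<comment> \<open>Moving the base point from \<open>y\<close> to \<open>x\<close> costs
      \<open>2 * norm (y - x)\<close>, at most \<open>t * e / 4\<close>. After division by
      \<open>t\<close> the total error is \<open>e / 2 + e / 4 < e\<close>.\<close>
    have "dist (SGN y) (SGN x) < e" if y: "dist y x < t * e / 8" for y
    proof -
      have "norm (SGN y - SGN x) \<le> e * 3 / 4"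
      proof (rule norm_blinfun_le_unit)
        fix h :: 'a assume h: "norm h = 1"
        have "t * blinfun_apply (SGN y) h
            = blinfun_apply (SGN y) ((x + t *\<^sub>R h) - y) + blinfun_apply (SGN y) (y - x)"
          by (simp add: blinfun.diff_right blinfun.add_right blinfun.scaleR_right)
        also have "\<dots> \<le> (norm (x + t *\<^sub>R h) - norm y) + norm (y - x)"
          using SGN_subgradient_diff[OF smooth] SGN_le[OF smooth] by (intro add_mono) auto
        also have "\<dots> \<le> (norm (x + t *\<^sub>R h) - norm x) + 2 * norm (y - x)"
          using norm_triangle_ineq3[of y x] by simp
        also have "\<dots> \<le> t * (blinfun_apply (SGN x) h + e / 2) + 2 * (t * e / 8)"
        proof (intro add_mono)
          have "(norm (x + t *\<^sub>R h) - norm x) / t \<le> blinfun_apply (SGN x) h + e / 2"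
            using d[OF _ _ h, of t] t by (smt (verit))
          then show "norm (x + t *\<^sub>R h) - norm x \<le> t * (blinfun_apply (SGN x) h + e / 2)"
            using t by (simp add: field_simps)
        qed (use y in \<open>simp add: dist_norm mult.commute\<close>)
        also have "\<dots> = t * (blinfun_apply (SGN x) h + e * 3 / 4)"
          by (simp add: algebra_simps)
        finally show "blinfun_apply (SGN y - SGN x) h \<le> e * 3 / 4"
          using t by (simp add: blinfun.diff_left)
      qed (use \<open>e > 0\<close> in simp)
      then show ?thesis using \<open>e > 0\<close> by (simp add: dist_norm)
    qed
    then show "\<exists>d>0. \<forall>y. dist y x < d \<longrightarrow> dist (SGN y) (SGN x) < e"
      using t \<open>e > 0\<close> by (intro exI[of _ "t * e / 8"]) auto
  qed
qed

section \<open>Weak compactness in reflexive spaces\<close>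

text \<open>Tychonoff's theorem yields a cluster point of the sequence in the product of the intervals
  \<open>[- R \<parallel>f\<parallel>, R \<parallel>f\<parallel>]\<close> over all functionals \<open>f\<close>. It is linear in \<open>f\<close>, hence an element of the bidual.\<close>

lemma reflexive_bounded_weak_cluster:
  fixes X :: "nat \<Rightarrow> 'a::real_normed_vector"
  assumes reflexive: "reflexive_space TYPE('a)" and bounded: "\<And>n. norm (X n) \<le> R"
  obtains G x where "G \<noteq> bot" "G \<le> sequentially"
    "\<forall>f :: 'a \<Rightarrow>\<^sub>L real. ((\<lambda>n. blinfun_apply f (X n)) \<longlongrightarrow> blinfun_apply f x) G"
proof -
  define ev :: "nat \<Rightarrow> ('a \<Rightarrow>\<^sub>L real) \<Rightarrow> real" where "ev n f = blinfun_apply f (X n)" for n f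
  define K :: "(('a \<Rightarrow>\<^sub>L real) \<Rightarrow> real) set" where "K = (\<Pi>\<^sub>E f\<in>UNIV. cball 0 (norm f * R))"
  have "compactin (product_topology (\<lambda>_. euclidean) UNIV) K"
    unfolding K_def by (subst compactin_PiE) auto
  then have "compact K"
    by (simp add: euclidean_product_topology)
  have ev_K: "ev n \<in> K" for n
  proof -
    have "\<bar>blinfun_apply f (X n)\<bar> \<le> norm f * R" for f
      using norm_blinfun[of f "X n"] mult_left_mono[OF bounded[of n] norm_ge_zero[of f]] by simp
    then show ?thesis by (simp add: K_def ev_def PiE_iff)
  qed
  then have "eventually (\<lambda>\<phi>. \<phi> \<in> K) (filtermap ev sequentially)"
    by (simp add: eventually_filtermap)
  moreover have "filtermap ev sequentially \<noteq> bot"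
    by (simp add: filtermap_bot_iff)
  ultimately obtain \<phi> where "\<phi> \<in> K" and \<phi>: "inf (nhds \<phi>) (filtermap ev sequentially) \<noteq> bot"
    using \<open>compact K\<close> unfolding compact_filter by blast
  \<comment> \<open>\<open>G\<close> lives on indices and plays the role of a convergent subnet:
    \<open>ev\<close> tends to \<open>\<phi>\<close> along it, and being finer than
    \<open>sequentially\<close> it keeps ordinary limits.\<close>
  define G where "G = inf (filtercomap ev (nhds \<phi>)) sequentially"
  have "G \<noteq> bot"
  proof
    assume "G = bot"
    then have "eventually (\<lambda>_. False) G" by simp
    then obtain P Q where P: "eventually P (filtercomap ev (nhds \<phi>))"
      and Q: "eventually Q sequentially" and PQ: "\<And>n. P n \<Longrightarrow> Q n \<Longrightarrow> False"
      unfolding G_def eventually_inf by blast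
    obtain P' where P': "eventually P' (nhds \<phi>)" "\<And>n. P' (ev n) \<Longrightarrow> P n"
      using P unfolding eventually_filtercomap by blast
    have "eventually (\<lambda>\<psi>. \<not> P' \<psi>) (filtermap ev sequentially)"
      unfolding eventually_filtermap using Q by eventually_elim (use P' PQ in blast)
    then have "eventually (\<lambda>_. False) (inf (nhds \<phi>) (filtermap ev sequentially))"
      using P'(1) unfolding eventually_inf by blast
    then show False using \<phi> by (simp add: trivial_limit_def)
  qed
  have "filterlim ev (nhds \<phi>) G"
    unfolding G_def by (rule filterlim_mono[OF filterlim_filtercomap]) auto
  then have lim: "((\<lambda>n. blinfun_apply f (X n)) \<longlongrightarrow> \<phi> f) G" for f
    using continuous_on_tendsto_compose[OF continuous_on_product_coordinates[of f], of ev \<phi> G]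
    by (simp add: ev_def)
  have "bounded_linear \<phi>"
  proof (rule bounded_linear_intro[where K = R])
    show "\<phi> (f + g) = \<phi> f + \<phi> g" for f g
    proof (rule tendsto_unique[OF \<open>G \<noteq> bot\<close> lim])
      show "((\<lambda>n. blinfun_apply (f + g) (X n)) \<longlongrightarrow> \<phi> f + \<phi> g) G"
        unfolding blinfun.add_left by (intro tendsto_intros lim)
    qed
    show "\<phi> (r *\<^sub>R f) = r *\<^sub>R \<phi> f" for r f
    proof (rule tendsto_unique[OF \<open>G \<noteq> bot\<close> lim])
      show "((\<lambda>n. blinfun_apply (r *\<^sub>R f) (X n)) \<longlongrightarrow> r *\<^sub>R \<phi> f) G"
        unfolding blinfun.scaleR_left by (intro tendsto_intros lim)
    qed
    show "norm (\<phi> f) \<le> norm f * R" for f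
      using \<open>\<phi> \<in> K\<close> by (auto simp: K_def PiE_iff)
  qed
  then obtain x where x: "\<And>f. \<phi> f = blinfun_apply f x"
    using reflexive unfolding reflexive_space_def by (metis bounded_linear_Blinfun_apply)
  have "((\<lambda>n. blinfun_apply f (X n)) \<longlongrightarrow> blinfun_apply f x) G" for f :: "'a \<Rightarrow>\<^sub>L real"
    using lim[of f] by (simp only: x)
  moreover have "G \<le> sequentially" by (simp add: G_def)
  ultimately show thesis using that \<open>G \<noteq> bot\<close> by blast
qed

text \<open>The point is a weak cluster point of a sequence in the unit ball along which
  \<open>f\<close> approaches \<open>norm f\<close>.\<close>

lemma reflexive_norm_attained:
  fixes f :: "'a::real_normed_vector \<Rightarrow>\<^sub>L real"
  assumes smooth: "smooth_space TYPE('a)" and reflexive: "reflexive_space TYPE('a)"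
  obtains h where "norm h \<le> 1" "blinfun_apply f h = norm f"
proof -
  have "\<exists>h. norm h \<le> 1 \<and> norm f - inverse (real (Suc n)) \<le> blinfun_apply f h" for n
  proof (rule ccontr)
    assume "\<not> ?thesis"
    then have less: "blinfun_apply f h < norm f - inverse (real (Suc n))" if "norm h \<le> 1" for h
      using that by (meson not_le)
    \<comment> \<open>The case \<open>h = 0\<close> of \<open>less\<close> supplies the
      nonnegativity of the bound.\<close>
    have "norm f \<le> norm f - inverse (real (Suc n))"
    proof (rule norm_blinfun_le_unit)
      show "0 \<le> norm f - inverse (real (Suc n))"
        using less[of 0] by simp
      show "blinfun_apply f h \<le> norm f - inverse (real (Suc n))" if "norm h = 1" for h
        using less[of h] that by simp
    qed
    then show False by simp
  qed
  then have "\<forall>n. \<exists>h. norm h \<le> 1 \<and> norm f - inverse (real (Suc n)) \<le> blinfun_apply f h" ..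
  from choice[OF this] obtain X
    where X': "\<forall>n. norm (X n) \<le> 1 \<and> norm f - inverse (real (Suc n)) \<le> blinfun_apply f (X n)" ..
  then have X: "norm (X n) \<le> 1" "norm f - inverse (real (Suc n)) \<le> blinfun_apply f (X n)" for n
    by simp_all
  obtain G h where G: "G \<noteq> bot" "G \<le> sequentially"
    and lim: "\<forall>f :: 'a \<Rightarrow>\<^sub>L real. ((\<lambda>n. blinfun_apply f (X n)) \<longlongrightarrow> blinfun_apply f h) G"
    by (rule reflexive_bounded_weak_cluster[where X = X, OF reflexive X(1)])
  \<comment> \<open>Smoothness provides the norming functional: \<open>SGN h\<close> is at most 1
    along the sequence, and its value at the cluster point \<open>h\<close> is
    \<open>norm h\<close>.\<close>
  have "blinfun_apply (SGN h) h \<le> 1"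
    using SGN_le[OF smooth] X(1)
    by (intro tendsto_upperbound[OF lim[rule_format] _ G(1)] always_eventually) (blast intro: order_trans)
  then have h: "norm h \<le> 1"
    by (simp add: SGN_self[OF smooth])
  have "((\<lambda>n. norm f - inverse (real (Suc n))) \<longlongrightarrow> norm f - 0) G"
    by (rule tendsto_mono[OF G(2)]) (intro tendsto_intros LIMSEQ_inverse_real_of_nat)
  then have "norm f \<le> blinfun_apply f h"
    using tendsto_le[OF G(1) lim[rule_format, of f] _ always_eventually, of _ "norm f - 0"] X(2) by simp
  moreover have "blinfun_apply f h \<le> norm f"
    using norm_blinfun[of f h] mult_left_mono[OF h norm_ge_zero[of f]] by simp
  ultimately show thesis using that h by force
qed

section \<open>The spatial distribution as a weak integral\<close>

text \<open>Evaluation at \<open>h\<close> is bounded and linear, so it commutes with the integral.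
  This reduces statements about dual-valued integrals to scalar ones.\<close>

lemma has_strong_bochner_integral_apply:
  fixes f :: "'b \<Rightarrow> 'a::real_normed_vector \<Rightarrow>\<^sub>L real"
  assumes "has_strong_bochner_integral M f I"
    and meas: "\<And>h. (\<lambda>w. blinfun_apply (f w) h) \<in> borel_measurable M"
  shows "has_bochner_integral M (\<lambda>w. blinfun_apply (f w) h) (blinfun_apply I h)"
proof -
  obtain s where s: "\<And>i. Bochner_Integration.simple_bochner_integrable M (s i)"
    and lim0: "(\<lambda>i. \<integral>\<^sup>+w. ennreal (norm (f w - s i w)) \<partial>M) \<longlonglongrightarrow> 0"
    and limI: "(\<lambda>i. Bochner_Integration.simple_bochner_integral M (s i)) \<longlonglongrightarrow> I"
    using assms(1) unfolding has_strong_bochner_integral_def by blast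
  have unit: "has_bochner_integral M (\<lambda>w. blinfun_apply (f w) h) (blinfun_apply I h)"
    if h: "norm h \<le> 1" for h
  proof (rule has_bochner_integral.intros[OF meas])
    show "Bochner_Integration.simple_bochner_integrable M (\<lambda>w. blinfun_apply (s i w) h)" for i
      \<comment> \<open>The composition rule is binary; the second argument is a dummy.\<close>
      using simple_bochner_integrable_compose2[OF _ s s, of "\<lambda>u v. blinfun_apply u h" i i] by simp
    show "(\<lambda>i. \<integral>\<^sup>+w. ennreal (norm (blinfun_apply (f w) h - blinfun_apply (s i w) h)) \<partial>M) \<longlonglongrightarrow> 0"
    proof (rule tendsto_sandwich[OF _ _ tendsto_const lim0])
      have "norm (blinfun_apply u h) \<le> norm u" for u :: "'a \<Rightarrow>\<^sub>L real"
        using norm_blinfun[of u h] mult_left_mono[OF h norm_ge_zero[of u]] by simp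
      then show "\<forall>\<^sub>F i in sequentially. (\<integral>\<^sup>+w. ennreal (norm (blinfun_apply (f w) h - blinfun_apply (s i w) h)) \<partial>M)
          \<le> (\<integral>\<^sup>+w. ennreal (norm (f w - s i w)) \<partial>M)"
        by (intro always_eventually allI nn_integral_mono ennreal_leI)
           (simp flip: blinfun.diff_left)
    qed simp
    have "Bochner_Integration.simple_bochner_integral M (\<lambda>w. blinfun_apply (s i w) h)
        = blinfun_apply (Bochner_Integration.simple_bochner_integral M (s i)) h" for i
      using simple_bochner_integral_linear[OF _ s, of "\<lambda>u. blinfun_apply u h"]
      by (simp add: bounded_linear.linear blinfun.bounded_linear_left)
    then show "(\<lambda>i. Bochner_Integration.simple_bochner_integral M (\<lambda>w. blinfun_apply (s i w) h)) \<longlonglongrightarrow> blinfun_apply I h"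
      by (simp add: tendsto_intros limI)
  qed
  \<comment> \<open>Rescaling puts \<open>h\<close> into the unit ball; the summand 1 keeps the
    factor positive when \<open>h = 0\<close>.\<close>
  let ?c = "norm h + 1"
  have "?c > 0" by (simp add: add_nonneg_pos)
  have "has_bochner_integral M (\<lambda>w. blinfun_apply (f w) (h /\<^sub>R ?c)) (blinfun_apply I (h /\<^sub>R ?c))"
    by (rule unit) (use \<open>?c > 0\<close> in \<open>simp add: field_simps\<close>)
  from has_bochner_integral_mult_right[OF this, of ?c]
  show ?thesis
    using \<open>?c > 0\<close> by (simp add: blinfun.scaleR_right flip: mult.assoc)
qed

lemma borel_measurable_SGN_apply:
  fixes h :: "'a::real_normed_vector"
  assumes smooth: "smooth_space TYPE('a)"
  shows "(\<lambda>w. blinfun_apply (SGN w) h) \<in> borel_measurable borel"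
proof (rule borel_measurable_LIMSEQ_real)
  let ?q = "\<lambda>n w. real (Suc n) * (norm (w + h /\<^sub>R real (Suc n)) - norm w)"
  \<comment> \<open>At \<open>w = 0\<close> the quotient is constantly \<open>norm h\<close>, so the
    value 0 has to be imposed there.\<close>
  show "(\<lambda>n. if w = 0 then 0 else ?q n w) \<longlonglongrightarrow> blinfun_apply (SGN w) h" for w
    using SGN_LIMSEQ[OF smooth, of w h] by (cases "w = 0") (auto simp: SGN_def)
  show "(\<lambda>w. if w = 0 then 0 else ?q n w) \<in> borel_measurable borel" for n
    by (intro measurable_If borel_measurable_continuous_onI continuous_intros) auto
qed

context
  fixes M :: "'a::banach measure"
  assumes smooth: "smooth_space TYPE('a)"
    and prob: "prob_space M"
    and borel: "sets M = sets borel"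
    and well_defined: "spatial_distribution_exists M"
begin

interpretation prob_space M by (rule prob)

lemma borel_measurable_continuous_M:
  "continuous_on UNIV (f :: 'a \<Rightarrow> real) \<Longrightarrow> f \<in> borel_measurable M"
  using borel_measurable_continuous_onI measurable_cong_sets[OF borel refl] by blast

lemma borel_measurable_SGN_diff: "(\<lambda>w. blinfun_apply (SGN (x - w)) h) \<in> borel_measurable M"
proof -
  have "(\<lambda>w. x - w) \<in> borel_measurable borel"
    by (intro borel_measurable_continuous_onI continuous_intros)
  from measurable_compose[OF this borel_measurable_SGN_apply[OF smooth]]
  show ?thesis by (simp add: measurable_cong_sets[OF borel refl])
qed

text \<open>Any two strong integrals agree at every \<open>h\<close> by uniqueness of the scalar
  integral. This resolves the definite description in
  \<open>strong_bochner_integral\<close>.\<close>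

lemma has_bochner_integral_SGN:
  "has_bochner_integral M (\<lambda>w. blinfun_apply (SGN (x - w)) h)
     (blinfun_apply (spatial_distribution M x) h)"
proof -
  let ?f = "\<lambda>w. SGN (x - w)"
  have weak: "has_bochner_integral M (\<lambda>w. blinfun_apply (?f w) h) (blinfun_apply I h)"
    if "has_strong_bochner_integral M ?f I" for I h
    by (rule has_strong_bochner_integral_apply[OF that borel_measurable_SGN_diff])
  obtain I where I: "has_strong_bochner_integral M ?f I"
    using well_defined unfolding spatial_distribution_exists_def strong_bochner_integrable_def by blast
  have "J = I" if "has_strong_bochner_integral M ?f J" for J
    using weak[OF I] weak[OF that] by (intro blinfun_eqI) (rule has_bochner_integral_eq)
  then have "spatial_distribution M x = I"
    unfolding spatial_distribution_def strong_bochner_integral_def using I by (rule the_equality[rotated])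
  then show ?thesis using weak[OF I] by simp
qed

lemma integrable_SGN: "integrable M (\<lambda>w. blinfun_apply (SGN (x - w)) h)"
  and spatial_distribution_apply:
    "blinfun_apply (spatial_distribution M x) h = (\<integral>w. blinfun_apply (SGN (x - w)) h \<partial>M)"
  using has_bochner_integral_SGN[of x h] by (auto simp: has_bochner_integral_iff)

section \<open>Strict monotonicity, and the range inside the open unit ball\<close>

lemma spatial_distribution_strict_mono:
  assumes convex: "strictly_convex_space TYPE('a)"
    and no_line: "\<not> supported_on_line M" and "x \<noteq> y"
  shows "blinfun_apply (spatial_distribution M x - spatial_distribution M y) (x - y) > 0"
proof -
  let ?f = "\<lambda>w. blinfun_apply (SGN (x - w)) (x - y) - blinfun_apply (SGN (y - w)) (x - y)"
  have int: "integrable M ?f" by (intro Bochner_Integration.integrable_diff integrable_SGN)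
  \<comment> \<open>The number \<open>norm (x - w) - norm (y - w)\<close> separates the two terms of
    \<open>?f w\<close>, so \<open>?f w = 0\<close> forces equality in both subgradient
    inequalities.\<close>
  have x: "blinfun_apply (SGN (x - w)) (x - y) \<ge> norm (x - w) - norm (y - w)" for w
    using SGN_subgradient_diff[OF smooth, of "x - w" "y - w"] by (simp add: blinfun.diff_right)
  have y: "blinfun_apply (SGN (y - w)) (x - y) \<le> norm (x - w) - norm (y - w)" for w
    using SGN_subgradient_diff[OF smooth, of "y - w" "x - w"] by simp
  have nonneg: "?f w \<ge> 0" for w
    using x[of w] y[of w] by simp
  have line: "w \<in> line_through x y" if "?f w = 0" for w
  proof -
    let ?a = "norm (x - w)" and ?b = "norm (y - w)"
    have "blinfun_apply (SGN (x - w)) (x - y) = ?a - ?b"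
      using x[of w] y[of w] that by simp
    moreover have "blinfun_apply (SGN (x - w)) (y - w) = ?a - blinfun_apply (SGN (x - w)) (x - y)"
      by (simp flip: SGN_self[OF smooth] blinfun.diff_right)
    ultimately have "blinfun_apply (SGN (x - w)) (y - w) = ?b" by simp
    from strictly_convex_SGN_eq_norm[OF smooth convex this]
    have eq: "?a *\<^sub>R (y - w) = ?b *\<^sub>R (x - w)" .
    then have eq': "(?a - ?b) *\<^sub>R w = ?a *\<^sub>R y - ?b *\<^sub>R x"
      by (simp add: algebra_simps)
    \<comment> \<open>Equal distances would give \<open>y - w = x - w\<close> or make both distances
      zero, hence \<open>x = y\<close>. So \<open>eq'\<close> can be solved for
      \<open>w\<close>.\<close>
    have "?a \<noteq> ?b"
    proof
      assume ab: "?a = ?b"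
      then have "y - w = x - w \<or> ?a = 0" using eq by simp
      then show False using ab \<open>x \<noteq> y\<close> by auto
    qed
    have "w = (1 / (?a - ?b)) *\<^sub>R ((?a - ?b) *\<^sub>R w)"
      using \<open>?a \<noteq> ?b\<close> by simp
    also have "\<dots> = (- ?b / (?a - ?b)) *\<^sub>R x + (?a / (?a - ?b)) *\<^sub>R y"
      unfolding eq' by (simp add: scaleR_diff_right)
    also have "?a / (?a - ?b) = 1 - (- ?b / (?a - ?b))"
      using \<open>?a \<noteq> ?b\<close> by (simp add: field_simps)
    finally show ?thesis unfolding line_through_def by blast
  qed
  have "(\<integral>w. ?f w \<partial>M) \<noteq> 0"
  proof
    assume "(\<integral>w. ?f w \<partial>M) = 0"
    then have "AE w in M. ?f w = 0"
      using integral_nonneg_eq_0_iff_AE[OF int] nonneg by simp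
    then have "AE w in M. w \<in> line_through x y"
      by eventually_elim (rule line)
    then show False using no_line unfolding supported_on_line_def by blast
  qed
  then have "(\<integral>w. ?f w \<partial>M) > 0"
    using Bochner_Integration.integral_nonneg[of M ?f] nonneg by (simp add: less_le)
  also have "(\<integral>w. ?f w \<partial>M) = blinfun_apply (spatial_distribution M x - spatial_distribution M y) (x - y)"
    by (simp add: blinfun.diff_left spatial_distribution_apply integrable_SGN)
  finally show ?thesis .
qed

lemma norm_spatial_distribution_less_1:
  assumes convex: "strictly_convex_space TYPE('a)" and reflexive: "reflexive_space TYPE('a)"
    and no_line: "\<not> supported_on_line M"
  shows "norm (spatial_distribution M x) < 1"
proof (rule ccontr)
  assume ge: "\<not> ?thesis"
  obtain h where h: "norm h \<le> 1"
    and attained: "blinfun_apply (spatial_distribution M x) h = norm (spatial_distribution M x)"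
    using reflexive_norm_attained[OF smooth reflexive] .
  let ?f = "\<lambda>w. 1 - blinfun_apply (SGN (x - w)) h"
  have int: "integrable M ?f" by (intro Bochner_Integration.integrable_diff integrable_SGN) simp
  have nonneg: "?f w \<ge> 0" for w
    using SGN_le[OF smooth, of "x - w" h] h by simp
  have "(\<integral>w. ?f w \<partial>M) = 1 - norm (spatial_distribution M x)"
    by (simp add: integrable_SGN prob_space flip: attained spatial_distribution_apply)
  moreover have "(\<integral>w. ?f w \<partial>M) \<ge> 0"
    using nonneg by (rule Bochner_Integration.integral_nonneg)
  ultimately have "(\<integral>w. ?f w \<partial>M) = 0" using ge by simp
  then have "AE w in M. ?f w = 0"
    using integral_nonneg_eq_0_iff_AE[OF int] nonneg by simp
  then have "AE w in M. w \<in> line_through x (x + h)"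
  proof eventually_elim
    fix w assume "?f w = 0"
    then have one: "blinfun_apply (SGN (x - w)) h = 1" by simp
    then have "norm h = 1" using SGN_le[OF smooth, of "x - w" h] h by simp
    with one have "norm (x - w) *\<^sub>R h = x - w"
      using strictly_convex_SGN_eq_norm[OF smooth convex, of "x - w" h] by simp
    \<comment> \<open>The coefficients sum to 1, and the combination collapses to
      \<open>x - norm (x - w) *\<^sub>R h\<close>.\<close>
    then have "w = (1 + norm (x - w)) *\<^sub>R x + (1 - (1 + norm (x - w))) *\<^sub>R (x + h)"
      by (simp add: algebra_simps)
    then show "w \<in> line_through x (x + h)" unfolding line_through_def by blast
  qed
  then show False using no_line unfolding supported_on_line_def by blast
qed

section \<open>Surjectivity by minimization\<close>

lemma integrable_norm_diff: "integrable M (\<lambda>w. norm (x - w) - norm (y - w))"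
proof (rule integrable_const_bound[where B = "norm (x - y)"])
  show "AE w in M. norm (norm (x - w) - norm (y - w)) \<le> norm (x - y)"
    using norm_triangle_ineq3[of "x - w" "y - w" for w] by simp
qed (intro borel_measurable_continuous_M continuous_intros)

text \<open>Subtracting \<open>norm (0 - w)\<close> bounds the integrand by \<open>norm x\<close>,
  so the integral is finite even if \<open>M\<close> has no first moment. Differences of values are
  unaffected.\<close>

definition potential :: "'a \<Rightarrow> real" where
  "potential x = (\<integral>w. (norm (x - w) - norm (0 - w)) \<partial>M)"

lemma potential_diff: "potential y - potential x = (\<integral>w. (norm (y - w) - norm (x - w)) \<partial>M)"
  using Bochner_Integration.integral_diff[OF integrable_norm_diff[of y 0] integrable_norm_diff[of x 0]]
  by (simp add: potential_def)

lemma potential_subgradient: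
  "blinfun_apply (spatial_distribution M x) (y - x) \<le> potential y - potential x"
  unfolding potential_diff spatial_distribution_apply
  using SGN_subgradient_diff[OF smooth, of "x - w" "y - w" for w]
  by (intro integral_mono integrable_SGN integrable_norm_diff) simp

text \<open>Dominated convergence with the constant bound \<open>norm h\<close>. Nonatomicity
  discards \<open>w = x\<close>, where the norm of \<open>x - w\<close> is not covered by
  smoothness.\<close>

lemma potential_LIMSEQ:
  assumes nonatomic: "nonatomic M"
  shows "(\<lambda>n. real (Suc n) * (potential (x + h /\<^sub>R real (Suc n)) - potential x))
           \<longlonglongrightarrow> blinfun_apply (spatial_distribution M x) h"
proof -
  let ?q = "\<lambda>n w. real (Suc n) * (norm ((x - w) + h /\<^sub>R real (Suc n)) - norm (x - w))"
  have "AE w in M. w \<noteq> x"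
    using nonatomic borel unfolding nonatomic_def by (intro AE_I[of _ _ "{x}"]) auto
  then have "AE w in M. (\<lambda>n. ?q n w) \<longlonglongrightarrow> blinfun_apply (SGN (x - w)) h"
    by eventually_elim (rule SGN_LIMSEQ[OF smooth], simp)
  then have "(\<lambda>n. \<integral>w. ?q n w \<partial>M) \<longlonglongrightarrow> (\<integral>w. blinfun_apply (SGN (x - w)) h \<partial>M)"
    using abs_norm_quotient_le[of "real (Suc n)" "x - w" h for n w]
    by (intro integral_dominated_convergence[where w = "\<lambda>_. norm h"] borel_measurable_SGN_diff
          borel_measurable_continuous_M continuous_intros) auto
  moreover have "(\<integral>w. ?q n w \<partial>M) = real (Suc n) * (potential (x + h /\<^sub>R real (Suc n)) - potential x)" for n
    unfolding potential_diff by (simp add: diff_add_eq del: of_nat_Suc)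
  ultimately show ?thesis
    by (simp only: spatial_distribution_apply)
qed

text \<open>The integrand falls short of \<open>norm x\<close> by at most
  \<open>2 * min (norm x) (norm w)\<close>. For large \<open>norm x\<close> this is a small multiple
  of \<open>norm x\<close> on average, because the bounded functions \<open>?m n\<close> tend to 0
  pointwise.\<close>

lemma potential_coercive:
  assumes "e > 0"
  obtains R where "R > 0" "\<And>x. norm x \<ge> R \<Longrightarrow> potential x \<ge> (1 - e) * norm x"
proof -
  let ?m = "\<lambda>n w. min 1 (norm (w::'a) / real (Suc n))"
  have meas: "?m n \<in> borel_measurable M" for n
    by (rule borel_measurable_continuous_M) (auto intro!: continuous_intros)
  have int: "integrable M (?m n)" for n
    by (rule integrable_const_bound[where B = 1, OF _ meas]) auto
  have "(\<lambda>n. ?m n w) \<longlonglongrightarrow> min 1 0" for w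
    using tendsto_mult[OF tendsto_const LIMSEQ_inverse_real_of_nat, of "norm w"]
    by (intro tendsto_min tendsto_const) (simp add: divide_inverse)
  then have "(\<lambda>n. \<integral>w. ?m n w \<partial>M) \<longlonglongrightarrow> (\<integral>w. 0 \<partial>M)"
    by (intro integral_dominated_convergence[where w = "\<lambda>_. 1"] meas) auto
  then have "\<forall>\<^sub>F n in sequentially. (\<integral>w. ?m n w \<partial>M) < e / 2"
    using assms by (intro order_tendstoD) auto
  then obtain n where n: "(\<integral>w. ?m n w \<partial>M) < e / 2"
    by (meson eventually_happens sequentially_bot)
  show thesis
  proof (rule that[of "real (Suc n)"])
    fix x :: 'a assume x: "norm x \<ge> real (Suc n)"
    have ptw: "norm x - 2 * norm x * ?m n w \<le> norm (x - w) - norm (0 - w)" for w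
    proof -
      have "min (norm x) (norm w) \<le> norm x * ?m n w"
      proof (cases "norm w \<le> real (Suc n)")
        case True
        then have m: "?m n w = norm w / real (Suc n)" by (simp del: of_nat_Suc)
        have "norm w * real (Suc n) \<le> norm w * norm x"
          by (rule mult_left_mono[OF x]) simp
        then have "norm w \<le> norm x * (norm w / real (Suc n))"
          by (simp add: field_simps)
        then show ?thesis unfolding m by linarith
      next
        case False
        then have "?m n w = 1" by simp
        then show ?thesis by simp
      qed
      then show ?thesis
        using norm_triangle_ineq2[of x w] norm_triangle_ineq2[of w x]
        by (simp add: norm_minus_commute min_def split: if_splits)
    qed
    have "(1 - e) * norm x \<le> norm x - 2 * norm x * (\<integral>w. ?m n w \<partial>M)"
    proof -
      have "norm x * (\<integral>w. ?m n w \<partial>M) \<le> norm x * (e / 2)"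
        using n by (intro mult_left_mono) auto
      then show ?thesis by (simp add: algebra_simps)
    qed
    also have "\<dots> = (\<integral>w. norm x - 2 * norm x * ?m n w \<partial>M)"
      using int by (simp add: prob_space)
    also have "\<dots> \<le> potential x"
      unfolding potential_def using int
      by (intro integral_mono integrable_norm_diff ptw) auto
    finally show "potential x \<ge> (1 - e) * norm x" .
  qed simp
qed

text \<open>The minimizer below comes from a weak cluster point of a minimizing sequence: the convex
  function is weakly lower semicontinuous there because \<open>spatial_distribution M x - f\<close> is a
  subgradient.\<close>

lemma spatial_distribution_surj:
  assumes reflexive: "reflexive_space TYPE('a)" and nonatomic: "nonatomic M"
    and f: "norm f < 1"
  shows "f \<in> range (spatial_distribution M)"
proof -
  define g where "g x = potential x - blinfun_apply f x" for x
  have f_le: "\<bar>blinfun_apply f x\<bar> \<le> norm f * norm x" for x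
    using norm_blinfun[of f x] by simp
  have g_lower: "g y \<ge> g x + blinfun_apply (spatial_distribution M x - f) (y - x)" for x y
    using potential_subgradient[of x y] by (simp add: g_def blinfun.diff_left blinfun.diff_right)
  \<comment> \<open>With \<open>e = 1 - norm f\<close> the growth rate is \<open>norm f\<close>,
    just enough to compensate \<open>f\<close>: outside the ball \<open>g\<close> is at least
    \<open>g 0 = 0\<close>.\<close>
  obtain R where "R > 0" and R: "\<And>x. norm x \<ge> R \<Longrightarrow> potential x \<ge> (1 - (1 - norm f)) * norm (x::'a)"
    using potential_coercive[of "1 - norm f"] f by auto
  have g_outside: "g 0 \<le> g x" if "norm x \<ge> R" for x
    using R[OF that] f_le[of x] by (simp add: g_def potential_def)
  have bdd: "bdd_below (g ` cball 0 R)"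
  proof (rule bdd_belowI2)
    fix x :: 'a assume "x \<in> cball 0 R"
    then have x: "norm x \<le> R" by simp
    have "\<bar>blinfun_apply (spatial_distribution M 0 - f) x\<bar> \<le> norm (spatial_distribution M 0 - f) * R"
      using norm_blinfun[of "spatial_distribution M 0 - f" x]
        mult_left_mono[OF x norm_ge_zero[of "spatial_distribution M 0 - f"]] by simp
    then show "g 0 - norm (spatial_distribution M 0 - f) * R \<le> g x"
      using g_lower[of 0 x] by simp
  qed
  define m where "m = (INF x\<in>cball 0 R. g x)"
  have m_le: "m \<le> g x" if "norm x \<le> R" for x
    unfolding m_def using that by (intro cINF_lower[OF bdd]) simp
  have m_min: "m \<le> g x" for x
    using m_le[of x] m_le[of 0] g_outside[of x] \<open>R > 0\<close> by (cases "norm x \<le> R") auto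
  have "\<exists>x. norm x \<le> R \<and> g x < m + inverse (real (Suc n))" for n
  proof -
    have "cball 0 R \<noteq> ({} :: 'a set)" using \<open>R > 0\<close> by simp
    then have "\<exists>x\<in>cball 0 R. g x < m + inverse (real (Suc n))"
      using cINF_less_iff[OF _ bdd, of "m + inverse (real (Suc n))"] unfolding m_def by simp
    then show ?thesis by auto
  qed
  then have "\<forall>n. \<exists>x. norm x \<le> R \<and> g x < m + inverse (real (Suc n))" ..
  from choice[OF this] obtain X
    where X': "\<forall>n. norm (X n) \<le> R \<and> g (X n) < m + inverse (real (Suc n))" ..
  then have X: "norm (X n) \<le> R" "g (X n) < m + inverse (real (Suc n))" for n
    by simp_all
  obtain G x where G: "G \<noteq> bot" "G \<le> sequentially"
    and lim: "\<forall>p :: 'a \<Rightarrow>\<^sub>L real. ((\<lambda>n. blinfun_apply p (X n)) \<longlongrightarrow> blinfun_apply p x) G"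
    by (rule reflexive_bounded_weak_cluster[where X = X, OF reflexive X(1)])
  let ?p = "spatial_distribution M x - f"
  have "((\<lambda>n. m + inverse (real (Suc n))) \<longlongrightarrow> m + 0) G"
    by (rule tendsto_mono[OF G(2)]) (intro tendsto_intros LIMSEQ_inverse_real_of_nat)
  moreover have "((\<lambda>n. g x + (blinfun_apply ?p (X n) - blinfun_apply ?p x))
      \<longlongrightarrow> g x + (blinfun_apply ?p x - blinfun_apply ?p x)) G"
    by (intro tendsto_intros lim[rule_format])
  moreover have "g x + (blinfun_apply ?p (X n) - blinfun_apply ?p x) \<le> m + inverse (real (Suc n))" for n
    using g_lower[of x "X n"] X(2)[of n] by (simp add: blinfun.diff_right)
  ultimately have "g x + (blinfun_apply ?p x - blinfun_apply ?p x) \<le> m + 0"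
    using tendsto_le[OF G(1)] always_eventually by blast
  then have min: "g x \<le> g y" for y
    using m_min[of y] by simp
  \<comment> \<open>Minimality at \<open>x\<close> bounds each difference quotient of
    \<open>potential\<close> below by \<open>f h\<close>. Applying the limit to \<open>- h\<close>
    as well gives equality.\<close>
  have "blinfun_apply f h \<le> blinfun_apply (spatial_distribution M x) h" for h
  proof (rule LIMSEQ_le_const[OF potential_LIMSEQ[OF nonatomic]])
    have "blinfun_apply f h \<le> real (Suc n) * (potential (x + h /\<^sub>R real (Suc n)) - potential x)" for n
    proof -
      have "blinfun_apply f (h /\<^sub>R real (Suc n)) \<le> potential (x + h /\<^sub>R real (Suc n)) - potential x"
        using min[of "x + h /\<^sub>R real (Suc n)"] by (simp add: g_def blinfun.add_right)
      then have "real (Suc n) * blinfun_apply f (h /\<^sub>R real (Suc n))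
          \<le> real (Suc n) * (potential (x + h /\<^sub>R real (Suc n)) - potential x)"
        by (intro mult_left_mono) auto
      then show ?thesis
        by (simp add: blinfun.scaleR_right flip: mult.assoc del: of_nat_Suc)
    qed
    then show "\<exists>N. \<forall>n\<ge>N. blinfun_apply f h \<le> real (Suc n) * (potential (x + h /\<^sub>R real (Suc n)) - potential x)"
      by blast
  qed
  from this[of h for h] this[of "- h" for h] have "f = spatial_distribution M x"
    by (intro blinfun_eqI antisym) (auto simp: blinfun.minus_right)
  then show ?thesis by blast
qed

section \<open>Continuity\<close>

text \<open>Testing on unit vectors bounds the norm of the difference of two values by the scalar
  integral of \<open>d n\<close>, to which dominated convergence applies.\<close>

lemma continuous_spatial_distribution:
  assumes frechet: "frechet_differentiable_norm TYPE('a)" and nonatomic: "nonatomic M"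
  shows "continuous_on UNIV (spatial_distribution M)"
proof (rule continuous_on_sequentiallyI)
  fix X x assume X: "X \<longlonglongrightarrow> (x::'a)"
  define d where "d n w = norm (SGN (X n - w) - SGN (x - w))" for n w
  have meas: "d n \<in> borel_measurable M" for n
  proof -
    \<comment> \<open>Continuity off two points yields Borel measurability of \<open>d n\<close>
      directly, although the difference inside the norm takes values in the dual.\<close>
    have "isCont (d n) w" if "w \<noteq> X n" "w \<noteq> x" for w
      unfolding d_def using that
      by (intro continuous_intros isCont_o2[OF _ isCont_SGN[OF frechet]]) auto
    then have "continuous_on (- {X n, x}) (d n)"
      by (intro continuous_at_imp_continuous_on) auto
    then have "d n \<in> borel_measurable borel"
      by (intro borel_measurable_continuous_countable_exceptions[of "{X n, x}"]) auto
    then show ?thesis by (simp add: measurable_cong_sets[OF borel refl])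
  qed
  have d_le: "\<bar>d n w\<bar> \<le> 2" for n w
    using norm_triangle_ineq4[of "SGN (X n - w)" "SGN (x - w)"]
      norm_SGN_le[OF smooth, of "X n - w"] norm_SGN_le[OF smooth, of "x - w"]
    by (simp add: d_def)
  have int: "integrable M (d n)" for n
    by (rule integrable_const_bound[where B = 2]) (auto intro: meas d_le)
  \<comment> \<open>Continuity of \<open>SGN\<close> is available only off 0; nonatomicity makes the
    exceptional point \<open>w = x\<close> null.\<close>
  have "AE w in M. w \<noteq> x"
    using nonatomic borel unfolding nonatomic_def by (intro AE_I[of _ _ "{x}"]) auto
  then have "AE w in M. (\<lambda>n. d n w) \<longlonglongrightarrow> 0"
  proof eventually_elim
    fix w assume "w \<noteq> x"
    then have "(\<lambda>n. SGN (X n - w)) \<longlonglongrightarrow> SGN (x - w)"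
      by (intro isCont_tendsto_compose[OF isCont_SGN[OF frechet]] tendsto_intros X) simp
    then show "(\<lambda>n. d n w) \<longlonglongrightarrow> 0"
      unfolding d_def by (intro tendsto_norm_zero LIM_zero)
  qed
  then have "(\<lambda>n. \<integral>w. d n w \<partial>M) \<longlonglongrightarrow> (\<integral>w. 0 \<partial>M)"
    using d_le by (intro integral_dominated_convergence[where w = "\<lambda>_. 2"] meas) auto
  then have lim: "(\<lambda>n. \<integral>w. d n w \<partial>M) \<longlonglongrightarrow> 0" by simp
  have "norm (spatial_distribution M (X n) - spatial_distribution M x) \<le> (\<integral>w. d n w \<partial>M)" for n
  proof (rule norm_blinfun_le_unit)
    show "0 \<le> (\<integral>w. d n w \<partial>M)" by (simp add: d_def)
    fix h :: 'a assume h: "norm h = 1"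
    have "blinfun_apply (spatial_distribution M (X n) - spatial_distribution M x) h
        = (\<integral>w. blinfun_apply (SGN (X n - w)) h - blinfun_apply (SGN (x - w)) h \<partial>M)"
      by (simp add: blinfun.diff_left spatial_distribution_apply integrable_SGN)
    also have "\<dots> \<le> (\<integral>w. d n w \<partial>M)"
    proof (intro integral_mono Bochner_Integration.integrable_diff integrable_SGN int)
      fix w
      show "blinfun_apply (SGN (X n - w)) h - blinfun_apply (SGN (x - w)) h \<le> d n w"
        using norm_blinfun[of "SGN (X n - w) - SGN (x - w)" h] h
        by (simp add: d_def blinfun.diff_left)
    qed
    finally show "blinfun_apply (spatial_distribution M (X n) - spatial_distribution M x) h
        \<le> (\<integral>w. d n w \<partial>M)" .
  qed
  then have "(\<lambda>n. spatial_distribution M (X n) - spatial_distribution M x) \<longlonglongrightarrow> 0"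
    by (intro Lim_null_comparison[OF _ lim] always_eventually) auto
  then show "(\<lambda>n. spatial_distribution M (X n)) \<longlonglongrightarrow> spatial_distribution M x"
    by (rule LIM_zero_cancel)
qed

end

theorem theorem3p1:
  fixes M :: "'a::banach measure"
  assumes smooth: "smooth_space TYPE('a)"
    and strictly_convex: "strictly_convex_space TYPE('a)"
    and prob: "prob_space M"
    and borel: "sets M = sets borel"
    and nonatomic: "nonatomic M"
    and well_defined: "spatial_distribution_exists M"
  shows "(\<not> supported_on_line M \<longrightarrow>
           (\<forall>x y. x \<noteq> y \<longrightarrow>
              blinfun_apply (spatial_distribution M x - spatial_distribution M y) (x - y) > 0)) \<and>
         (\<not> supported_on_line M \<longrightarrow> reflexive_space TYPE('a) \<longrightarrow>
           range (spatial_distribution M) = ball 0 1) \<and>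
         (frechet_differentiable_norm TYPE('a) \<longrightarrow>
           continuous_on UNIV (spatial_distribution M))"
proof (intro conjI impI allI)
  note M = smooth prob borel well_defined
  show "blinfun_apply (spatial_distribution M x - spatial_distribution M y) (x - y) > 0"
    if "\<not> supported_on_line M" "x \<noteq> y" for x y
    by (rule spatial_distribution_strict_mono[OF M strictly_convex that])
  show "range (spatial_distribution M) = ball 0 1"
    if "\<not> supported_on_line M" "reflexive_space TYPE('a)"
    using norm_spatial_distribution_less_1[OF M strictly_convex that(2,1)]
      spatial_distribution_surj[OF M that(2) nonatomic] by auto
  show "continuous_on UNIV (spatial_distribution M)" if "frechet_differentiable_norm TYPE('a)"
    by (rule continuous_spatial_distribution[OF M that nonatomic])
qed

end
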